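(* Let $n=2$ and let $A, B \subset \mathbb{R}^2$ be non-empty compact sets which admit an external Hausdorff distance with radius $r > 0$. Assume that the grid is rotated randomly with respect to the external line. Then, with probability one (i.e. for almost every rotation angle $\theta$ of the grid), there exists a sequence $(h_m)_{m \in \mathbb{N}}$ of positive grid spacings with $h_m \to 0$ such that the approximation error $\delta = d_H(A,B) - \tilde{d}(A,B)$ satisfies $$\delta \le \frac{45}{r^2} \cdot h_m h^2$$ for all $m \in \mathbb{N}$ and all large enough grids (with this rotation angle) of spacing $h < h_m$. In particular, the approximation error vanishes super-quadratically in the grid spacing, i.e. $\delta / h^2 \to 0$ as $h \to 0$.
   Context: $|\cdot|$ is the Euclidean norm on $\mathbb{R}^2$; $\overline{B_s(p)}$ is the closed ball of radius $s$ around $p$. For a set $\Omega \subset \mathbb{R}^2$, $d_\Omega(x) = \inf_{y \in \Omega} |x-y|$. The Hausdorff distance is $d_H(A,B) = \max(d(A \to B), d(B \to A))$ with $d(A \to B) = \sup_{x \in A} \inf_{y \in B} |x-y|$. External Hausdorff distance: assume $d_H(A,B) = d(A \to B) = |x-y| > 0$ with $x \in A$ and $y \in B$. Let $r>0$ and set $d = (x-y)/|x-y|$, $c = x + r d$ and $R = r + d_H(A,B)$. One says that $A$ and $B$ admit an external Hausdorff distance with radius $r$ if $\overline{B_r(c)} \cap A = \{x\}$ and $\overline{B_R(c)} \cap B = \{y\}$. The external line is the line segment $\{x + \tau d : 0 \le \tau \le r\}$. Rotated grid: a grid with rotation angle $\theta \in [0,2\pi)$ and spacing $h>0$ has the finite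 set of grid points $N = \{p + h\, U_\theta\, j : j \in \mathbb{Z}^2,\ 0 \le j_i \le K_i,\ i=1,2\}$ for some $p \in \mathbb{R}^2$ and integers $K_1, K_2 \ge 1$, where $U_\theta$ is the rotation of $\mathbb{R}^2$ by $\theta$. Its cells are the squares of side length $h$ (with sides parallel to $U_\theta e_1, U_\theta e_2$) whose corners are grid points. The angle $\theta$ is random with uniform distribution, so "with probability one" means for Lebesgue-almost every $\theta$. The grid is large enough if every point of $A \cup B$ and every point of the external line lies in some closed grid cell. The grid approximation of the Hausdorff distance is $\tilde{d}(A,B) = \max_{z \in N} |d_A(z) - d_B(z)|$. *)

theory Defs
  imports "HOL-Analysis.Analysis"
begin

type_synonym plane = "real ^ 2"

definition directed_hausdorff :: "plane set \<Rightarrow> plane set \<Rightarrow> real" where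
  "directed_hausdorff A B = (SUP x\<in>A. infdist x B)"

definition hausdorff_distance :: "plane set \<Rightarrow> plane set \<Rightarrow> real" where
  "hausdorff_distance A B = max (directed_hausdorff A B) (directed_hausdorff B A)"

definition external_direction :: "plane \<Rightarrow> plane \<Rightarrow> plane" where
  "external_direction x y = (x - y) /\<^sub>R norm (x - y)"

text \<open>The maximising pair \<open>x\<close>, \<open>y\<close> need not be determined by \<open>A\<close> and \<open>B\<close>, and the external line
  depends on it; hence the pair is a parameter instead of being hidden under an existential
  quantifier.\<close>

definition external_hausdorff ::
    "plane set \<Rightarrow> plane set \<Rightarrow> plane \<Rightarrow> plane \<Rightarrow> real \<Rightarrow> bool" where
  "external_hausdorff A B x y r \<longleftrightarrow>
     x \<in> A \<and> y \<in> B \<and>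
     hausdorff_distance A B = directed_hausdorff A B \<and>
     directed_hausdorff A B = norm (x - y) \<and> norm (x - y) > 0 \<and>
     (let c = x + r *\<^sub>R external_direction x y; R = r + hausdorff_distance A B
      in cball c r \<inter> A = {x} \<and> cball c R \<inter> B = {y})"

definition external_line :: "plane \<Rightarrow> plane \<Rightarrow> real \<Rightarrow> plane set" where
  "external_line x y r = {x + \<tau> *\<^sub>R external_direction x y | \<tau>. 0 \<le> \<tau> \<and> \<tau> \<le> r}"

definition rotation :: "real \<Rightarrow> real ^ 2 ^ 2" where
  "rotation \<theta> = vector [vector [cos \<theta>, - sin \<theta>], vector [sin \<theta>, cos \<theta>]]"

definition grid_points :: "plane \<Rightarrow> real \<Rightarrow> real \<Rightarrow> int ^ 2 \<Rightarrow> plane set" where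
  "grid_points p \<theta> h K =
     {p + h *\<^sub>R (rotation \<theta> *v (\<chi> i. real_of_int (j $ i))) | j :: int ^ 2.
        \<forall>i. 0 \<le> j $ i \<and> j $ i \<le> K $ i}"

text \<open>With \<open>S = {0..1}\<close> this is the closed square with corner \<open>q\<close>, side length \<open>h\<close> and sides
  parallel to the rotated axes; with \<open>S = {0, 1}\<close> it is the set of the four corners of that
  square.\<close>

definition rotated_square :: "plane \<Rightarrow> real \<Rightarrow> real \<Rightarrow> real set \<Rightarrow> plane set" where
  "rotated_square q \<theta> h S = (\<lambda>t. q + h *\<^sub>R (rotation \<theta> *v t)) ` {t. \<forall>i. t $ i \<in> S}"

definition grid_cells :: "plane \<Rightarrow> real \<Rightarrow> real \<Rightarrow> int ^ 2 \<Rightarrow> plane set set" where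
  "grid_cells p \<theta> h K =
     {rotated_square q \<theta> h {0..1} | q. rotated_square q \<theta> h {0, 1} \<subseteq> grid_points p \<theta> h K}"

definition large_enough_grid ::
    "plane set \<Rightarrow> plane set \<Rightarrow> plane \<Rightarrow> plane \<Rightarrow> real \<Rightarrow> plane \<Rightarrow> real \<Rightarrow> real \<Rightarrow> int ^ 2 \<Rightarrow> bool" where
  "large_enough_grid A B x y r p \<theta> h K \<longleftrightarrow>
     (\<forall>i. K $ i \<ge> 1) \<and> A \<union> B \<union> external_line x y r \<subseteq> \<Union> (grid_cells p \<theta> h K)"

definition grid_hausdorff :: "plane set \<Rightarrow> plane set \<Rightarrow> plane set \<Rightarrow> real" where
  "grid_hausdorff N A B = Max ((\<lambda>z. \<bar>infdist z A - infdist z B\<bar>) ` N)"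

definition approximation_error ::
    "plane set \<Rightarrow> plane set \<Rightarrow> plane \<Rightarrow> real \<Rightarrow> real \<Rightarrow> int ^ 2 \<Rightarrow> real" where
  "approximation_error A B p \<theta> h K =
     hausdorff_distance A B - grid_hausdorff (grid_points p \<theta> h K) A B"

end

theory Submission
  imports Defs
begin

text \<open>On the external line, \<open>d\<^sub>B - d\<^sub>A\<close> equals the Hausdorff distance. A point at a small distance \<open>e\<close>
  from the middle third of the line loses only \<open>4 e\<^sup>2 / r\<close>, because the circles around \<open>x\<close> and \<open>c\<close>
  that bound \<open>d\<^sub>A\<close> and \<open>d\<^sub>B\<close> cross the line perpendicularly. For almost every \<open>\<theta>\<close> the external
  line has irrational slope in grid coordinates. By Dirichlet, the slope has infinitely many
  approximations \<open>a / q\<close> with error below \<open>1 / q\<^sup>2\<close>; since the multiples of \<open>a / q\<close> are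
  equidistributed modulo 1, among any \<open>q\<close> consecutive grid lines crossed by the external line, one
  has a grid point within \<open>3 h / (2 q)\<close>. With \<open>h\<^sub>m = r / (5 q)\<close>, the middle third of the external
  line crosses \<open>q\<close> consecutive grid lines for all \<open>h < h\<^sub>m\<close>.\<close>

section \<open>Inhomogeneous approximation\<close>

text \<open>Put \<open>\<gamma> = \<alpha> * n + \<beta>\<close> and let \<open>t / q\<close> be the
  fraction nearest to it, at distance at most \<open>1 / (2 q)\<close>. Some \<open>k\<close> in
  \<open>{0..<q}\<close> makes \<open>(t + k * a) / q\<close> an integer \<open>v\<close>; replacing
  \<open>\<alpha>\<close> by \<open>a / q\<close> over \<open>k < q\<close> steps costs at most
  another \<open>1 / q\<close>.\<close>

lemma inhomogeneous_approximation:
  fixes \<alpha> \<beta> :: real and a q n :: int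
  assumes "coprime a q" "q > 0" and approx: "\<bar>\<alpha> - a / q\<bar> < 1 / (real_of_int q)\<^sup>2"
  obtains u v :: int where "n \<le> u" "u < n + q" "\<bar>\<alpha> * u + \<beta> - v\<bar> \<le> 3 / (2 * real_of_int q)"
proof -
  define \<gamma> where "\<gamma> = \<alpha> * n + \<beta>"
  define t where "t = round (q * \<gamma>)"
  obtain b c where bc: "b * a + c * q = 1"
    using bezout_int[of a q] assms(1) by auto
  \<comment> \<open>By Bezout \<open>b\<close> inverts \<open>a\<close> modulo \<open>q\<close>, so
    this \<open>k\<close> solves \<open>t + k * a = 0\<close> modulo \<open>q\<close>.\<close>
  define k where "k = (- t * b) mod q"
  have k: "0 \<le> k" "k < q" using \<open>q > 0\<close> by (auto simp: k_def)
  have "(t + k * a) mod q = (t + (- t * b) * a) mod q"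
    unfolding k_def by (metis mod_add_right_eq mod_mult_left_eq)
  also have "t + (- t * b) * a = t * (c * q)"
  proof -
    have "t + (- t * b) * a = t * (1 - b * a)" by (simp add: algebra_simps)
    also have "1 - b * a = c * q" using bc by simp
    finally show ?thesis .
  qed
  finally have "q dvd t + k * a"
    by (simp add: dvd_eq_mod_eq_0)
  then obtain v where "t + k * a = q * v" ..
  then have v: "real_of_int t + k * a = q * v"
    by (metis of_int_add of_int_mult)
  have "\<bar>q * \<gamma> - t\<bar> \<le> 1 / 2"
    unfolding t_def using of_int_round_abs_le[of "q * \<gamma>"] by (simp add: abs_minus_commute)
  then have 1: "\<bar>(q * \<gamma> - t) / q\<bar> \<le> 1 / (2 * real_of_int q)"
    using \<open>q > 0\<close> by (simp add: abs_divide field_simps)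
  have "\<bar>k * (\<alpha> - a / q)\<bar> = k * \<bar>\<alpha> - a / q\<bar>"
    using k by (simp add: abs_mult)
  also have "\<dots> \<le> q * (1 / (real_of_int q)\<^sup>2)"
    by (rule mult_mono) (use k approx \<open>q > 0\<close> in auto)
  also have "\<dots> = 1 / q"
    using \<open>q > 0\<close> by (simp add: power2_eq_square)
  finally have 2: "\<bar>k * (\<alpha> - a / q)\<bar> \<le> 1 / q" .
  have split: "\<alpha> * (n + k) + \<beta> - v = (q * \<gamma> - t) / q + k * (\<alpha> - a / q)"
  proof -
    have "real_of_int v = (t + k * a) / q" using v \<open>q > 0\<close> by simp
    then show ?thesis using \<open>q > 0\<close> by (simp add: \<gamma>_def field_simps)
  qed
  have "\<bar>\<alpha> * (n + k) + \<beta> - v\<bar> \<le> 1 / (2 * real_of_int q) + 1 / q"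
    unfolding split by (rule order.trans[OF abs_triangle_ineq add_mono[OF 1 2]])
  also have "\<dots> = 3 / (2 * real_of_int q)" using \<open>q > 0\<close> by (simp add: field_simps)
  finally show thesis
    using that[of "n + k" v] k by simp
qed

text \<open>Dirichlet: an irrational has infinitely many such reduced fractions, so their
  denominators are unbounded.\<close>

lemma irrational_approximation:
  fixes \<alpha> :: real and N :: int
  assumes "\<alpha> \<notin> \<rat>"
  obtains a q :: int where "coprime a q" "q > 0" "q > N" "\<bar>\<alpha> - a / q\<bar> < 1 / (real_of_int q)\<^sup>2"
proof -
  have "infinite (approx_set \<alpha>)"
    using assms rational_iff_finite_approx_set by blast
  from infinite_approx_set[OF this, of N] show thesis
    using that by (auto simp: approx_set_def)
qed

section \<open>Rotated grids\<close>

lemma rotation_nth [simp]: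
  "(rotation \<theta> *v t) $ 1 = cos \<theta> * t $ 1 - sin \<theta> * t $ 2"
  "(rotation \<theta> *v t) $ 2 = sin \<theta> * t $ 1 + cos \<theta> * t $ 2"
  by (simp_all add: rotation_def matrix_vector_mult_def sum_2)

lemma norm_plane: "(norm (t :: plane))\<^sup>2 = (t $ 1)\<^sup>2 + (t $ 2)\<^sup>2"
  by (simp add: norm_vec_def L2_set_def sum_2)

lemma norm_rotation [simp]: "norm (rotation \<theta> *v t) = norm t"
proof -
  have "(c * t $ 1 - s * t $ 2)\<^sup>2 + (s * t $ 1 + c * t $ 2)\<^sup>2
      = (s\<^sup>2 + c\<^sup>2) * ((t $ 1)\<^sup>2 + (t $ 2)\<^sup>2)" for c s :: real
    by (simp add: power2_eq_square algebra_simps)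
  from this[of "cos \<theta>" "sin \<theta>"] have "(norm (rotation \<theta> *v t))\<^sup>2 = (norm t)\<^sup>2"
    by (simp add: norm_plane)
  then show ?thesis by simp
qed

lemma rotation_inverse [simp]: "rotation \<theta> *v (rotation (- \<theta>) *v t) = t"
proof -
  have "c * (c * a + s * b) - s * (c * b - s * a) = (s\<^sup>2 + c\<^sup>2) * a"
    "s * (c * a + s * b) + c * (c * b - s * a) = (s\<^sup>2 + c\<^sup>2) * b" for a b c s :: real
    by (simp_all add: power2_eq_square algebra_simps)
  note id = this
  show ?thesis
    using id(1)[of "cos \<theta>" _ "sin \<theta>"] id(2)[of "sin \<theta>" "cos \<theta>"]
    by (simp add: vec_eq_iff forall_2)
qed

lemma rotation_eq_iff [simp]: "rotation \<theta> *v s = rotation \<theta> *v t \<longleftrightarrow> s = t"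
proof -
  have "norm (rotation \<theta> *v (s - t)) = norm (s - t)" by simp
  then show ?thesis
    by (metis matrix_vector_mult_diff_distrib norm_eq_zero right_minus_eq)
qed

lemma finite_grid_points: "finite (grid_points p \<theta> h K)"
proof -
  let ?J = "{j :: int ^ 2. \<forall>i. 0 \<le> j $ i \<and> j $ i \<le> K $ i}"
  have "inj_on (\<lambda>j. (j $ 1, j $ 2)) ?J"
    by (auto simp: inj_on_def vec_eq_iff forall_2)
  moreover have "(\<lambda>j. (j $ 1, j $ 2)) ` ?J \<subseteq> {0..K $ 1} \<times> {0..K $ 2}"
    by auto
  ultimately have "finite ?J"
    by (meson finite_SigmaI finite_atLeastAtMost_int inj_on_finite)
  then have "finite ((\<lambda>j. p + h *\<^sub>R (rotation \<theta> *v (\<chi> i. real_of_int (j $ i)))) ` ?J)"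
    by simp
  then show ?thesis
    by (rule rev_finite_subset) (auto simp: grid_points_def)
qed

text \<open>Allows rounding points of cells to grid points without leaving the grid. The lowest
  corner of the cell gives the bound \<open>0\<close>, the opposite corner the bound
  \<open>K\<close>.\<close>

lemma grid_cells_coordinates:
  assumes "p + h *\<^sub>R (rotation \<theta> *v \<sigma>) \<in> \<Union> (grid_cells p \<theta> h K)" and "h > 0"
  shows "0 \<le> \<sigma> $ i \<and> \<sigma> $ i \<le> K $ i"
proof -
  obtain c t where corners: "rotated_square c \<theta> h {0, 1} \<subseteq> grid_points p \<theta> h K"
    and t: "\<forall>i. t $ i \<in> {0..1}" "p + h *\<^sub>R (rotation \<theta> *v \<sigma>) = c + h *\<^sub>R (rotation \<theta> *v t)"
    using assms(1) by (auto simp: grid_cells_def rotated_square_def)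
  have corner: "c + h *\<^sub>R (rotation \<theta> *v e) \<in> grid_points p \<theta> h K" if "\<forall>i. e $ i \<in> {0, 1}" for e
    using corners that by (auto simp: rotated_square_def)
  obtain j where j: "\<forall>i. 0 \<le> j $ i" "c = p + h *\<^sub>R (rotation \<theta> *v (\<chi> i. real_of_int (j $ i)))"
    using corner[of 0] by (auto simp: grid_points_def)
  obtain l where l: "\<forall>i. l $ i \<le> K $ i"
    "c + h *\<^sub>R (rotation \<theta> *v 1) = p + h *\<^sub>R (rotation \<theta> *v (\<chi> i. real_of_int (l $ i)))"
    using corner[of 1] by (auto simp: grid_points_def)
  \<comment> \<open>The corner \<open>1\<close> is the corner \<open>0\<close> shifted by one unit
    in both grid coordinates, so \<open>l = j + 1\<close>.\<close>
  have "h *\<^sub>R (rotation \<theta> *v ((\<chi> i. real_of_int (j $ i)) + 1)) =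
      h *\<^sub>R (rotation \<theta> *v (\<chi> i. real_of_int (l $ i)))"
    using l(2) j(2) by (simp add: matrix_vector_right_distrib scaleR_add_right)
  then have "(\<chi> i. real_of_int (j $ i)) + 1 = (\<chi> i. real_of_int (l $ i))"
    using \<open>h > 0\<close> by simp
  then have jl: "real_of_int (j $ i) + 1 = real_of_int (l $ i)"
    by (simp add: vec_eq_iff)
  have "h *\<^sub>R (rotation \<theta> *v \<sigma>) = h *\<^sub>R (rotation \<theta> *v ((\<chi> i. real_of_int (j $ i)) + t))"
    using t(2) j(2) by (simp add: matrix_vector_right_distrib scaleR_add_right)
  then have "\<sigma> = (\<chi> i. real_of_int (j $ i)) + t"
    using \<open>h > 0\<close> by simp
  then have "\<sigma> $ i = real_of_int (j $ i) + t $ i" by simp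
  moreover have "0 \<le> real_of_int (j $ i)" "real_of_int (l $ i) \<le> real_of_int (K $ i)"
    using j(1) l(1) by (simp_all only: of_int_0_le_iff of_int_le_iff)
  ultimately show ?thesis
    using t(1)[rule_format, of i] jl by simp
qed

lemma norm_axis: "norm (axis k c :: real ^ 'n) = \<bar>c\<bar>"
  by (simp add: norm_eq_sqrt_inner inner_axis_axis)

text \<open>In grid coordinates the external line is the graph of
  \<open>\<alpha> * u + \<beta>\<close> over its dominant coordinate \<open>i\<close>. Its middle
  third crosses at least \<open>q\<close> consecutive grid lines \<open>u\<close>, and the
  inhomogeneous approximation finds one that it crosses close to an integer height
  \<open>v\<close>.\<close>

lemma grid_point_near_line:
  fixes \<theta> :: real and d x p :: plane and i k :: 2
  defines "w \<equiv> rotation (- \<theta>) *v d"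
  assumes "i \<noteq> k" and "norm d = 1" and ki: "\<bar>w $ k\<bar> \<le> \<bar>w $ i\<bar>"
    and "coprime a q" and "q \<ge> 2" and approx: "\<bar>w $ k / w $ i - a / q\<bar> < 1 / (real_of_int q)\<^sup>2"
    and "0 < h" and hq: "h < r / (5 * real_of_int q)"
    and cells: "\<And>\<tau>. 0 \<le> \<tau> \<Longrightarrow> \<tau> \<le> r \<Longrightarrow> x + \<tau> *\<^sub>R d \<in> \<Union> (grid_cells p \<theta> h K)"
  obtains z \<tau> where "z \<in> grid_points p \<theta> h K" "r / 3 \<le> \<tau>" "\<tau> \<le> 2 * r / 3"
    "norm (z - (x + \<tau> *\<^sub>R d)) \<le> 3 * h / (2 * real_of_int q)"
proof -
  have univ: "l = i \<or> l = k" for l :: 2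
    using \<open>i \<noteq> k\<close> exhaust_2[of i] exhaust_2[of k] exhaust_2[of l] by auto
  have "r > 0"
    using \<open>0 < h\<close> hq \<open>q \<ge> 2\<close> by (smt (verit) divide_nonpos_pos of_int_pos)
  have ws: "(w $ i)\<^sup>2 + (w $ k)\<^sup>2 = 1"
  proof -
    have "(w $ 1)\<^sup>2 + (w $ 2)\<^sup>2 = 1"
      using norm_plane[of w] \<open>norm d = 1\<close> by (simp add: w_def)
    then show ?thesis
      using \<open>i \<noteq> k\<close> exhaust_2[of i] exhaust_2[of k] by auto
  qed
  moreover have "(w $ k)\<^sup>2 \<le> (w $ i)\<^sup>2"
    using ki by (simp add: abs_le_square_iff)
  \<comment> \<open>The dominant coordinate of a unit vector is at least \<open>1 / sqrt 2\<close>;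
    \<open>7 / 10\<close> is a rational bound below it. With \<open>5 * q * h < r\<close> it makes
    the middle third at least \<open>7 q / 6\<close> grid units long in direction
    \<open>i\<close>.\<close>
  ultimately have "(7 / 10)\<^sup>2 \<le> (w $ i)\<^sup>2"
    by (simp add: power2_eq_square)
  then have wi: "7 / 10 \<le> \<bar>w $ i\<bar>"
    by (simp flip: abs_le_square_iff)
  then have wi0: "w $ i \<noteq> 0" by auto
  define s where "s = (1 / h) *\<^sub>R (rotation (- \<theta>) *v (x - p))"
  have line: "x + \<tau> *\<^sub>R d = p + h *\<^sub>R (rotation \<theta> *v (s + (\<tau> / h) *\<^sub>R w))" for \<tau>
    using \<open>0 < h\<close>
    by (simp add: s_def w_def matrix_vector_right_distrib matrix_vector_mult_scaleR scaleR_add_right)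
  define \<alpha> \<beta> where "\<alpha> = w $ k / w $ i" and "\<beta> = s $ k - \<alpha> * s $ i"
  \<comment> \<open>The lower end of the middle third in coordinate \<open>i\<close>;
    \<open>min\<close> covers both signs of \<open>w $ i\<close>.\<close>
  define lo where "lo = min (s $ i + r / (3 * h) * w $ i) (s $ i + 2 * r / (3 * h) * w $ i)"
  obtain u v :: int where u: "\<lceil>lo\<rceil> \<le> u" "u < \<lceil>lo\<rceil> + q" and v: "\<bar>\<alpha> * u + \<beta> - v\<bar> \<le> 3 / (2 * real_of_int q)"
    using inhomogeneous_approximation[of a q \<alpha> "\<lceil>lo\<rceil>" \<beta>] assms(5-7) unfolding \<alpha>_def by auto
  \<comment> \<open>The parameter at which the external line crosses the grid line with
    \<open>i\<close>-th coordinate \<open>u\<close>.\<close>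
  define \<tau> where "\<tau> = h * (u - s $ i) / w $ i"
  have "q * (5 * h) < r"
    using hq \<open>q \<ge> 2\<close> by (simp add: field_simps)
  have "q \<le> r / (3 * h) * \<bar>w $ i\<bar>"
  proof -
    have "q \<le> r / (3 * h) * (7 / 10)"
      using \<open>q * (5 * h) < r\<close> \<open>0 < h\<close> \<open>r > 0\<close> by (simp add: field_simps)
    also have "\<dots> \<le> r / (3 * h) * \<bar>w $ i\<bar>"
      by (rule mult_left_mono) (use wi \<open>0 < h\<close> \<open>r > 0\<close> in auto)
    finally show ?thesis .
  qed
  \<comment> \<open>The integer \<open>u\<close> is at most
    \<open>\<lceil>lo\<rceil> + q - 1\<close>, and \<open>\<lceil>lo\<rceil> < lo + 1\<close>, so
    rounding up \<open>lo\<close> does not push \<open>u\<close> out of the window of length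
    \<open>q\<close>.\<close>
  moreover have "lo \<le> u" "u < lo + q"
    using u by linarith+
  ultimately have ulo: "lo \<le> u" "u \<le> lo + r / (3 * h) * \<bar>w $ i\<bar>"
    by linarith+
  have \<tau>: "r / 3 \<le> \<tau>" "\<tau> \<le> 2 * r / 3"
  proof -
    have "r / (3 * h) \<le> (u - s $ i) / w $ i \<and> (u - s $ i) / w $ i \<le> 2 * r / (3 * h)"
    proof (cases "w $ i > 0")
      case True
      then have "r / (3 * h) * w $ i \<le> 2 * r / (3 * h) * w $ i"
        using \<open>0 < h\<close> \<open>r > 0\<close> by (simp add: field_simps)
      then have "lo = s $ i + r / (3 * h) * w $ i"
        by (simp add: lo_def)
      with ulo True have "r / (3 * h) * w $ i \<le> u - s $ i"
        "u - s $ i \<le> 2 * r / (3 * h) * w $ i" by simp_all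
      with True show ?thesis by (simp add: pos_le_divide_eq pos_divide_le_eq)
    next
      case False
      then have neg: "w $ i < 0" using wi0 by simp
      then have "2 * r / (3 * h) * w $ i \<le> r / (3 * h) * w $ i"
        using \<open>0 < h\<close> \<open>r > 0\<close> by (simp add: field_simps)
      then have "lo = s $ i + 2 * r / (3 * h) * w $ i"
        by (simp add: lo_def)
      with ulo neg have "2 * r / (3 * h) * w $ i \<le> u - s $ i"
        "u - s $ i \<le> r / (3 * h) * w $ i" by simp_all
      with neg show ?thesis by (simp add: neg_le_divide_eq neg_divide_le_eq)
    qed
    then show "r / 3 \<le> \<tau>" "\<tau> \<le> 2 * r / 3"
      using \<open>0 < h\<close> unfolding \<tau>_def by (simp_all add: field_simps)
  qed
  define \<sigma> where "\<sigma> = s + (\<tau> / h) *\<^sub>R w"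
  have \<tau>h: "\<tau> / h = (u - s $ i) / w $ i"
    using \<open>0 < h\<close> by (simp add: \<tau>_def)
  have \<sigma>i: "\<sigma> $ i = u"
    using wi0 by (simp add: \<sigma>_def \<tau>h)
  have \<sigma>k: "\<sigma> $ k = \<alpha> * u + \<beta>"
    using wi0 by (simp add: \<sigma>_def \<tau>h \<alpha>_def \<beta>_def field_simps)
  have "p + h *\<^sub>R (rotation \<theta> *v \<sigma>) \<in> \<Union> (grid_cells p \<theta> h K)"
    using cells[of \<tau>] \<tau> \<open>r > 0\<close> unfolding line \<sigma>_def by simp
  note box = grid_cells_coordinates[OF this \<open>0 < h\<close>]
  \<comment> \<open>Here \<open>q \<ge> 2\<close> enters: \<open>v\<close> is less than 1 away from
    a number between the integers \<open>0\<close> and \<open>K $ k\<close>, hence lies between them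
    itself.\<close>
  have "3 / (2 * real_of_int q) < 1"
    using \<open>q \<ge> 2\<close> by simp
  with v \<sigma>k have "\<bar>\<sigma> $ k - v\<bar> < 1" by simp
  then have "0 \<le> v" "v \<le> K $ k"
    using box[of k] by linarith+
  moreover have "0 \<le> u" "u \<le> K $ i"
    using box[of i] \<sigma>i by simp_all
  moreover define j :: "int ^ 2" where "j = (\<chi> l. if l = i then u else v)"
  ultimately have j: "\<forall>l. 0 \<le> j $ l \<and> j $ l \<le> K $ l"
    using univ by auto
  define z where "z = p + h *\<^sub>R (rotation \<theta> *v (\<chi> l. real_of_int (j $ l)))"
  have "z \<in> grid_points p \<theta> h K"
    using j by (auto simp: z_def grid_points_def)
  moreover have "norm (z - (x + \<tau> *\<^sub>R d)) \<le> 3 * h / (2 * real_of_int q)"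
  proof -
    \<comment> \<open>Coordinate \<open>i\<close> of the crossing point is exactly \<open>u\<close>,
      so the whole deviation lies along axis \<open>k\<close>.\<close>
    have "(\<chi> l. real_of_int (j $ l)) - \<sigma> = axis k (v - \<sigma> $ k)"
      unfolding vec_eq_iff
    proof
      fix l
      show "((\<chi> l. real_of_int (j $ l)) - \<sigma>) $ l = axis k (v - \<sigma> $ k) $ l"
        using univ[of l] \<open>i \<noteq> k\<close> \<sigma>i by (auto simp: j_def axis_def)
    qed
    moreover have "z - (x + \<tau> *\<^sub>R d) = h *\<^sub>R (rotation \<theta> *v ((\<chi> l. real_of_int (j $ l)) - \<sigma>))"
      unfolding line z_def \<sigma>_def
      by (simp add: matrix_vector_mult_diff_distrib scaleR_diff_right)
    ultimately have "norm (z - (x + \<tau> *\<^sub>R d)) = h * \<bar>v - \<sigma> $ k\<bar>"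
      using \<open>0 < h\<close> by (simp add: norm_axis)
    also have "\<dots> \<le> h * (3 / (2 * real_of_int q))"
      using v \<open>0 < h\<close> \<sigma>k by (intro mult_left_mono) (auto simp: abs_minus_commute)
    finally show ?thesis by simp
  qed
  ultimately show thesis
    using that \<tau> by blast
qed

section \<open>Distance functions and the Hausdorff distance\<close>

text \<open>Go from \<open>z\<close> through its nearest point \<open>a\<close> of \<open>A\<close>:
  this costs \<open>infdist z A\<close> plus \<open>infdist a B\<close>. Compactness makes the
  supremum over \<open>A\<close> finite.\<close>

lemma infdist_diff_le_directed_hausdorff:
  fixes A B :: "plane set"
  assumes "A \<noteq> {}" "compact A" "B \<noteq> {}" "compact B"
  shows "infdist z B - infdist z A \<le> directed_hausdorff A B"
proof -
  obtain a where a: "a \<in> A" "infdist z A = dist z a"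
    using infdist_attains_inf[of A z] assms compact_imp_closed by blast
  have "compact ((\<lambda>x. infdist x B) ` A)"
    by (intro compact_continuous_image continuous_intros assms)
  then have "bdd_above ((\<lambda>x. infdist x B) ` A)"
    by (simp add: bounded_imp_bdd_above compact_imp_bounded)
  with a have "infdist a B \<le> directed_hausdorff A B"
    unfolding directed_hausdorff_def by (intro cSUP_upper)
  then show ?thesis
    using infdist_triangle[of z B a] a by simp
qed

text \<open>Supplies the lower half of the limit of the error divided by \<open>h\<^sup>2\<close>.
  The grid must be non-empty for the \<open>Max\<close> over it to be meaningful.\<close>

lemma approximation_error_nonneg:
  assumes "A \<noteq> {}" "compact A" "B \<noteq> {}" "compact B" and "grid_points p \<theta> h K \<noteq> {}"
  shows "0 \<le> approximation_error A B p \<theta> h K"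
proof -
  have "\<bar>infdist z A - infdist z B\<bar> \<le> hausdorff_distance A B" for z
    using infdist_diff_le_directed_hausdorff[OF assms(1-4), of z]
      infdist_diff_le_directed_hausdorff[OF assms(3,4,1,2), of z]
    unfolding hausdorff_distance_def by linarith
  then have "grid_hausdorff (grid_points p \<theta> h K) A B \<le> hausdorff_distance A B"
    unfolding grid_hausdorff_def using assms(5) finite_grid_points by (subst Max_le_iff) auto
  then show ?thesis by (simp add: approximation_error_def)
qed

text \<open>The tangent bound for the square root, by completing the square.\<close>

lemma sqrt_le_add_square:
  fixes t e :: real
  assumes "t > 0" "m\<^sup>2 \<le> t\<^sup>2 + e\<^sup>2"
  shows "m \<le> t + e\<^sup>2 / (2 * t)"
proof (rule power2_le_imp_le)
  have "t\<^sup>2 + e\<^sup>2 \<le> t\<^sup>2 + e\<^sup>2 + (e\<^sup>2 / (2 * t))\<^sup>2" by simp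
  also have "\<dots> = (t + e\<^sup>2 / (2 * t))\<^sup>2"
    using \<open>t > 0\<close> by (simp add: power2_sum)
  finally show "m\<^sup>2 \<le> (t + e\<^sup>2 / (2 * t))\<^sup>2" using assms(2) by simp
qed (use assms in auto)

text \<open>\<open>infdist z A\<close> is at most the distance to \<open>x\<close>, and
  \<open>infdist z B\<close> is at least \<open>r + D\<close> minus the distance to
  \<open>c\<close>. With \<open>t\<close> the coordinate of \<open>z\<close> along the line, these
  distances exceed \<open>t\<close> and \<open>r - t\<close> by at most
  \<open>2 * e\<^sup>2 / r\<close> each, and \<open>t\<close> cancels.\<close>

lemma infdist_diff_near_external_line:
  fixes A B :: "plane set" and x y :: plane
  defines "d \<equiv> external_direction x y"
  assumes ext: "external_hausdorff A B x y r" and "r > 0"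
    and \<tau>: "r / 3 \<le> \<tau>" "\<tau> \<le> 2 * r / 3"
    and e: "norm (z - (x + \<tau> *\<^sub>R d)) \<le> e" "e \<le> r / 12"
  shows "hausdorff_distance A B - 4 * e\<^sup>2 / r \<le> infdist z B - infdist z A"
proof -
  define D where "D = norm (x - y)"
  define c where "c = x + r *\<^sub>R d"
  have "x \<in> A" "y \<in> B" and D: "hausdorff_distance A B = D" "D > 0"
    using ext unfolding external_hausdorff_def D_def by (blast, blast, metis, blast)
  have "cball c (r + hausdorff_distance A B) \<inter> B = {y}"
    using ext unfolding external_hausdorff_def Let_def c_def d_def by blast
  then have ball: "cball c (r + D) \<inter> B = {y}"
    by (simp only: D(1))
  have d: "norm d = 1"
    using D(2) by (simp add: d_def external_direction_def D_def)
  then have dd: "d \<bullet> d = 1" by (simp add: norm_eq_1)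
  have "x - y = D *\<^sub>R d"
    using D(2) by (simp add: d_def external_direction_def D_def)
  then have "c - y = (r + D) *\<^sub>R d"
    by (simp add: c_def algebra_simps)
  then have cy: "dist c y = r + D"
    using d \<open>r > 0\<close> D(2) by (simp add: dist_norm)
  \<comment> \<open>A point of \<open>B\<close> closer to \<open>c\<close> would have to be
    \<open>y\<close>, which is at distance exactly \<open>r + D\<close>.\<close>
  have away: "r + D \<le> dist c b" if "b \<in> B" for b
  proof (rule ccontr)
    assume "\<not> r + D \<le> dist c b"
    then have "b \<in> cball c (r + D) \<inter> B" using that by simp
    then have "b = y" using ball by simp
    then show False using cy \<open>\<not> r + D \<le> dist c b\<close> by simp
  qed
  define t where "t = (z - x) \<bullet> d"
  have "\<bar>t - \<tau>\<bar> = \<bar>(z - (x + \<tau> *\<^sub>R d)) \<bullet> d\<bar>"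
    using dd by (simp add: t_def algebra_simps)
  also have "\<dots> \<le> e"
    using Cauchy_Schwarz_ineq2[of "z - (x + \<tau> *\<^sub>R d)" d] d e by simp
  \<comment> \<open>\<open>r / 3 - r / 12 = r / 4\<close>, so \<open>t\<close> and
    \<open>r - t\<close> both stay at least \<open>r / 4\<close>.\<close>
  finally have t: "r / 4 \<le> t" "t \<le> 3 * r / 4"
    using \<tau> e by linarith+
  \<comment> \<open>Pythagoras: both sides are the squared distance of \<open>z\<close> from the
    line through \<open>x\<close> and \<open>c\<close>.\<close>
  have "(norm (z - x))\<^sup>2 - t\<^sup>2 = (norm (z - (x + \<tau> *\<^sub>R d)))\<^sup>2 - (t - \<tau>)\<^sup>2"
    unfolding power2_norm_eq_inner using dd
    by (simp add: t_def power2_eq_square algebra_simps inner_commute)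
  also have "\<dots> \<le> (norm (z - (x + \<tau> *\<^sub>R d)))\<^sup>2" by simp
  also have "\<dots> \<le> e\<^sup>2"
    using e by (intro power_mono) auto
  finally have zx2: "(norm (z - x))\<^sup>2 \<le> t\<^sup>2 + e\<^sup>2" by simp
  have "(norm (z - c))\<^sup>2 = (norm (z - x))\<^sup>2 - t\<^sup>2 + (r - t)\<^sup>2"
    unfolding power2_norm_eq_inner using dd
    by (simp add: t_def c_def power2_eq_square algebra_simps inner_commute)
  with zx2 have zc2: "(norm (z - c))\<^sup>2 \<le> (r - t)\<^sup>2 + e\<^sup>2" by simp
  have quot: "e\<^sup>2 / (2 * l) \<le> 2 * e\<^sup>2 / r" if "r / 4 \<le> l" for l
  proof -
    have "e\<^sup>2 / (2 * l) \<le> e\<^sup>2 / (r / 2)"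
      using that \<open>r > 0\<close> by (intro divide_left_mono) auto
    then show ?thesis by (simp add: mult.commute)
  qed
  have "norm (z - x) \<le> t + 2 * e\<^sup>2 / r"
    using sqrt_le_add_square[OF _ zx2] quot[of t] t \<open>r > 0\<close> by linarith
  moreover have "infdist z A \<le> norm (z - x)"
    using infdist_le[OF \<open>x \<in> A\<close>, of z] by (simp add: dist_norm)
  moreover have "norm (z - c) \<le> r - t + 2 * e\<^sup>2 / r"
    using sqrt_le_add_square[OF _ zc2] quot[of "r - t"] t \<open>r > 0\<close> by linarith
  moreover have "r + D - norm (z - c) \<le> infdist z B"
  proof (subst infdist_notempty; (intro cINF_greatest)?)
    fix b assume "b \<in> B"
    then show "r + D - norm (z - c) \<le> dist z b"
      using away[of b] dist_triangle[of c b z] by (simp add: dist_norm norm_minus_commute)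
  qed (use \<open>y \<in> B\<close> in auto)
  ultimately show ?thesis
    using D(1) by simp
qed

section \<open>Irrational slopes\<close>

text \<open>Where \<open>cos\<close> does not vanish, \<open>\<psi>\<close> differs from the
  arctangent of a rational by a multiple of \<open>pi\<close>. The zeros of \<open>cos\<close> have
  to be included, since \<open>tan\<close> takes the rational value 0 there by division by
  zero.\<close>

lemma countable_tan_rational: "countable {\<psi> :: real. tan \<psi> \<in> \<rat>}"
proof (rule countable_subset)
  let ?X = "range (\<lambda>i :: int. of_int i * (pi / 2)) \<union>
    (\<lambda>(s, i :: int). arctan s + of_int i * pi) ` (\<rat> \<times> UNIV)"
  show "countable ?X"
    by (intro countable_Un countable_image countable_SIGMA countable_rat) auto
  show "{\<psi>. tan \<psi> \<in> \<rat>} \<subseteq> ?X"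
  proof safe
    fix \<psi> :: real
    assume rat: "tan \<psi> \<in> \<rat>" and
      notin: "\<psi> \<notin> (\<lambda>(s, i :: int). arctan s + of_int i * pi) ` (\<rat> \<times> UNIV)"
    show "\<psi> \<in> range (\<lambda>i :: int. of_int i * (pi / 2))"
    proof (cases "cos \<psi> = 0")
      case True
      then show ?thesis by (auto simp: cos_zero_iff_int)
    next
      case False
      define t where "t = tan \<psi>"
      \<comment> \<open>Clearing denominators in this equality of tangents gives the subtraction
        formula for \<open>sin\<close>.\<close>
      have "sin (arctan t) / cos (arctan t) = sin \<psi> / cos \<psi>"
        using tan_arctan[of t] unfolding t_def tan_def .
      then have "sin (\<psi> - arctan t) = 0"
        using False cos_arctan_not_zero[of t] by (simp add: sin_diff field_simps)
      then obtain i :: int where "\<psi> - arctan t = of_int i * pi"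
        by (auto simp: sin_zero_iff_int2)
      then have "\<psi> = (\<lambda>(s, i :: int). arctan s + of_int i * pi) (tan \<psi>, i)"
        by (simp add: t_def)
      with rat notin show ?thesis by blast
    qed
  qed
qed

text \<open>If \<open>d\<close> has polar angle \<open>\<phi>\<close>, its slope in grid coordinates
  is \<open>tan (\<phi> - \<theta>)\<close>, which is rational for only countably many
  \<open>\<theta>\<close>.\<close>

lemma AE_irrational_slope:
  fixes d :: plane
  assumes "norm d = 1"
  shows "AE \<theta> in lborel. (rotation (- \<theta>) *v d) $ 2 / (rotation (- \<theta>) *v d) $ 1 \<notin> \<rat>"
proof -
  obtain \<phi> where \<phi>: "d $ 1 = cos \<phi>" "d $ 2 = sin \<phi>"
    using sincos_total_2pi[of "d $ 1" "d $ 2"] norm_plane[of d] assms by auto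
  have slope: "(rotation (- \<theta>) *v d) $ 2 / (rotation (- \<theta>) *v d) $ 1 = tan (\<phi> - \<theta>)" for \<theta>
    by (simp add: tan_def \<phi> cos_diff sin_diff mult.commute)
  have "{\<theta>. tan (\<phi> - \<theta>) \<in> \<rat>} \<subseteq> (\<lambda>\<psi>. \<phi> - \<psi>) ` {\<psi>. tan \<psi> \<in> \<rat>}"
  proof
    fix \<theta> assume "\<theta> \<in> {\<theta>. tan (\<phi> - \<theta>) \<in> \<rat>}"
    then show "\<theta> \<in> (\<lambda>\<psi>. \<phi> - \<psi>) ` {\<psi>. tan \<psi> \<in> \<rat>}"
      by (intro image_eqI[of _ _ "\<phi> - \<theta>"]) simp_all
  qed
  then have "countable {\<theta>. tan (\<phi> - \<theta>) \<in> \<rat>}"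
    by (rule countable_subset[OF _ countable_image[OF countable_tan_rational]])
  then have "AE \<theta> in lborel. \<theta> \<notin> {\<theta>. tan (\<phi> - \<theta>) \<in> \<rat>}"
    by (intro AE_not_in countable_imp_null_set_lborel)
  then show ?thesis by (simp only: slope mem_Collect_eq)
qed

section \<open>The approximation error\<close>

text \<open>A grid point at distance at most \<open>e = 3 * h / (2 * q)\<close> from the middle
  third loses at most \<open>4 * e\<^sup>2 / r\<close>. That the grid is non-empty is recorded for
  \<open>approximation_error_nonneg\<close>.\<close>

lemma approximation_error_le:
  fixes x y :: plane and \<theta> :: real and i k :: 2
  defines "d \<equiv> external_direction x y"
  defines "w \<equiv> rotation (- \<theta>) *v d"
  assumes ext: "external_hausdorff A B x y r" and "r > 0"
    and "i \<noteq> k" and "\<bar>w $ k\<bar> \<le> \<bar>w $ i\<bar>"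
    and "coprime a q" and "q \<ge> 2" and "\<bar>w $ k / w $ i - a / q\<bar> < 1 / (real_of_int q)\<^sup>2"
    and "0 < h" and hq: "h < r / (5 * real_of_int q)"
    and large: "large_enough_grid A B x y r p \<theta> h K"
  shows "grid_points p \<theta> h K \<noteq> {}"
    and "approximation_error A B p \<theta> h K \<le> 45 / r\<^sup>2 * (r / (5 * real_of_int q) * h\<^sup>2)"
proof -
  have "norm d = 1"
    using ext by (simp add: d_def external_direction_def external_hausdorff_def)
  moreover have "x + \<tau> *\<^sub>R d \<in> \<Union> (grid_cells p \<theta> h K)" if "0 \<le> \<tau>" "\<tau> \<le> r" for \<tau>
    using large that unfolding large_enough_grid_def external_line_def d_def by blast
  ultimately obtain z \<tau> where z: "z \<in> grid_points p \<theta> h K" and \<tau>: "r / 3 \<le> \<tau>" "\<tau> \<le> 2 * r / 3"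
    and near: "norm (z - (x + \<tau> *\<^sub>R d)) \<le> 3 * h / (2 * real_of_int q)"
    using grid_point_near_line[of i k d \<theta> a q h r x p K] assms by metis
  show "grid_points p \<theta> h K \<noteq> {}" using z by auto
  have "5 * h * q < r"
    using hq \<open>q \<ge> 2\<close> by (simp add: field_simps)
  moreover have "2 * h \<le> q * h" "2 * 2 \<le> q * real_of_int q"
    using \<open>q \<ge> 2\<close> \<open>0 < h\<close> by (intro mult_mono; simp)+
  \<comment> \<open>This is the condition \<open>e \<le> r / 12\<close> with denominators
    cleared.\<close>
  ultimately have "18 * h \<le> r * q"
  proof -
    have "18 * h \<le> 20 * h" using \<open>0 < h\<close> by simp
    also have "\<dots> \<le> 5 * h * q * q"
      using mult_left_mono[OF \<open>2 * 2 \<le> q * real_of_int q\<close>, of "5 * h"] \<open>0 < h\<close> by (simp add: mult.assoc)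
    also have "\<dots> \<le> r * q"
      using \<open>5 * h * q < r\<close> \<open>q \<ge> 2\<close> by (intro mult_right_mono) auto
    finally show ?thesis .
  qed
  then have "3 * h / (2 * real_of_int q) \<le> r / 12"
    using \<open>q \<ge> 2\<close> by (simp add: field_simps)
  then have "hausdorff_distance A B - 4 * (3 * h / (2 * real_of_int q))\<^sup>2 / r \<le> infdist z B - infdist z A"
    using infdist_diff_near_external_line[OF ext \<open>r > 0\<close> \<tau>] near unfolding d_def by blast
  also have "\<dots> \<le> \<bar>infdist z A - infdist z B\<bar>" by simp
  also have "\<dots> \<le> grid_hausdorff (grid_points p \<theta> h K) A B"
    unfolding grid_hausdorff_def using z finite_grid_points by (intro Max_ge) auto
  finally have "approximation_error A B p \<theta> h K \<le> 4 * (3 * h / (2 * real_of_int q))\<^sup>2 / r"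
    by (simp add: approximation_error_def)
  also have "\<dots> = 9 * h\<^sup>2 / r / (real_of_int q)\<^sup>2"
    by (simp add: power_mult_distrib power_divide)
  \<comment> \<open>One of the two factors \<open>1 / q\<close> is given up; the other is
    \<open>5 / r\<close> times the spacing bound \<open>r / (5 * q)\<close>, whence the constant
    45.\<close>
  also have "\<dots> \<le> 9 * h\<^sup>2 / r / q"
    using \<open>q \<ge> 2\<close> \<open>r > 0\<close> by (intro divide_left_mono) (auto simp: power2_eq_square)
  also have "\<dots> = 45 / r\<^sup>2 * (r / (5 * real_of_int q) * h\<^sup>2)"
    using \<open>r > 0\<close> \<open>q \<ge> 2\<close> by (simp add: power2_eq_square field_simps)
  finally show "approximation_error A B p \<theta> h K \<le> 45 / r\<^sup>2 * (r / (5 * real_of_int q) * h\<^sup>2)" .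
qed

theorem corollary4:
  fixes A B :: "plane set" and x y :: plane and r :: real
  assumes "A \<noteq> {}" and "compact A" and "B \<noteq> {}" and "compact B"
    and "r > 0" and "external_hausdorff A B x y r"
  shows "AE \<theta> in uniform_measure lborel {0..<2 * pi}.
    (\<exists>hs :: nat \<Rightarrow> real. (\<forall>m. hs m > 0) \<and> hs \<longlonglongrightarrow> 0 \<and>
       (\<forall>m h p K. 0 < h \<and> h < hs m \<and> large_enough_grid A B x y r p \<theta> h K \<longrightarrow>
          approximation_error A B p \<theta> h K \<le> 45 / r ^ 2 * (hs m * h ^ 2))) \<and>
    (\<forall>\<epsilon>>0. \<forall>\<^sub>F h in at_right 0. \<forall>p K. large_enough_grid A B x y r p \<theta> h K \<longrightarrow>
       \<bar>approximation_error A B p \<theta> h K / h ^ 2\<bar> < \<epsilon>)"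
proof (rule AE_uniform_measureI)
  define d where "d = external_direction x y"
  have "norm d = 1"
    using assms(6) by (simp add: d_def external_direction_def external_hausdorff_def)
  from AE_irrational_slope[OF this]
  show "AE \<theta> in lborel. \<theta> \<in> {0..<2 * pi} \<longrightarrow>
    (\<exists>hs :: nat \<Rightarrow> real. (\<forall>m. hs m > 0) \<and> hs \<longlonglongrightarrow> 0 \<and>
       (\<forall>m h p K. 0 < h \<and> h < hs m \<and> large_enough_grid A B x y r p \<theta> h K \<longrightarrow>
          approximation_error A B p \<theta> h K \<le> 45 / r ^ 2 * (hs m * h ^ 2))) \<and>
    (\<forall>\<epsilon>>0. \<forall>\<^sub>F h in at_right 0. \<forall>p K. large_enough_grid A B x y r p \<theta> h K \<longrightarrow>
       \<bar>approximation_error A B p \<theta> h K / h ^ 2\<bar> < \<epsilon>)"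
  proof eventually_elim
    case (elim \<theta>)
    define w where "w = rotation (- \<theta>) *v d"
    \<comment> \<open>Swapping the axes replaces the slope by its reciprocal, which is irrational as
      well.\<close>
    obtain i k :: 2 where ik: "i \<noteq> k" "\<bar>w $ k\<bar> \<le> \<bar>w $ i\<bar>" "w $ k / w $ i \<notin> \<rat>"
    proof (cases "\<bar>w $ 2\<bar> \<le> \<bar>w $ 1\<bar>")
      case True
      then show thesis using that[of 1 2] elim by (simp add: w_def)
    next
      case False
      have "w $ 1 / w $ 2 \<notin> \<rat>"
        using elim Rats_inverse[of "w $ 1 / w $ 2"] by (auto simp: w_def)
      then show thesis using False that[of 2 1] by simp
    qed
    \<comment> \<open>The bound \<open>int m + 1\<close> ensures both \<open>q \<ge> 2\<close> for
      every \<open>m\<close> and unbounded denominators, hence \<open>hs\<close> tends to 0.\<close>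
    have "\<exists>a q. coprime a q \<and> q > int m + 1 \<and> \<bar>w $ k / w $ i - of_int a / of_int q\<bar> < 1 / (of_int q)\<^sup>2"
      for m :: nat
      using irrational_approximation[OF ik(3)] by metis
    then obtain a q :: "nat \<Rightarrow> int" where cop: "\<And>m. coprime (a m) (q m)" and q: "\<And>m. q m > int m + 1"
      and approx: "\<And>m. \<bar>w $ k / w $ i - a m / q m\<bar> < 1 / (real_of_int (q m))\<^sup>2"
      by metis
    have q2: "q m \<ge> 2" for m using q[of m] by linarith
    define hs where "hs m = r / (5 * real_of_int (q m))" for m
    have pos: "hs m > 0" for m
      using \<open>r > 0\<close> q2[of m] by (simp add: hs_def)
    have lim: "hs \<longlonglongrightarrow> 0"
    proof (rule tendsto_sandwich[of "\<lambda>_. 0"])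
      show "\<forall>\<^sub>F m in sequentially. hs m \<le> r * inverse (real (Suc m))"
      proof (rule always_eventually, rule allI)
        fix m
        have "real_of_int (int m + 1) \<le> q m"
          using q[of m] by linarith
        then have "real (Suc m) \<le> 5 * q m"
          by simp
        then have "r / (5 * real_of_int (q m)) \<le> r / real (Suc m)"
          using \<open>r > 0\<close> by (intro divide_left_mono) auto
        then show "hs m \<le> r * inverse (real (Suc m))"
          by (simp only: hs_def divide_inverse)
      qed
      show "(\<lambda>m. r * inverse (real (Suc m))) \<longlonglongrightarrow> 0"
        using tendsto_mult_right_zero[OF LIMSEQ_inverse_real_of_nat] .
    qed (simp_all add: pos less_imp_le)
    have bound: "grid_points p \<theta> h K \<noteq> {} \<and>
        approximation_error A B p \<theta> h K \<le> 45 / r ^ 2 * (hs m * h ^ 2)"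
      if "0 < h" "h < hs m" "large_enough_grid A B x y r p \<theta> h K" for m h p K
      using approximation_error_le[OF assms(6,5) ik(1) ik(2)[unfolded w_def d_def] cop[of m] q2[of m]
          approx[of m, unfolded w_def d_def] that(1) that(2)[unfolded hs_def] that(3)]
      unfolding hs_def by (intro conjI)
    have "\<forall>\<^sub>F h in at_right 0. \<forall>p K. large_enough_grid A B x y r p \<theta> h K \<longrightarrow>
       \<bar>approximation_error A B p \<theta> h K / h ^ 2\<bar> < \<epsilon>" if "\<epsilon> > 0" for \<epsilon> :: real
    proof -
      have "(\<lambda>m. 45 / r ^ 2 * hs m) \<longlonglongrightarrow> 0"
        using lim by (rule tendsto_mult_right_zero)
      then have "\<forall>\<^sub>F m in sequentially. 45 / r ^ 2 * hs m < \<epsilon>"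
        using \<open>\<epsilon> > 0\<close> by (rule order_tendstoD)
      \<comment> \<open>A single \<open>m\<close> suffices for this \<open>\<epsilon>\<close>: the
        bound holds for all \<open>h\<close> below \<open>hs m\<close>.\<close>
      then obtain m where m: "45 / r ^ 2 * hs m < \<epsilon>"
        using eventually_happens by force
      have "\<forall>\<^sub>F h in at_right 0. h \<in> {0<..<hs m}"
        using pos by (rule eventually_at_right_real)
      then show ?thesis
      proof eventually_elim
        case (elim h)
        show ?case
        proof (intro allI impI)
          fix p K assume large: "large_enough_grid A B x y r p \<theta> h K"
          note b = bound[of h m, OF _ _ large]
          have "0 \<le> approximation_error A B p \<theta> h K"
            using b elim approximation_error_nonneg[OF assms(1-4)] by simp
          moreover have "approximation_error A B p \<theta> h K / h ^ 2 \<le> 45 / r ^ 2 * hs m"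
            using b elim by (simp add: pos_divide_le_eq mult.assoc)
          ultimately show "\<bar>approximation_error A B p \<theta> h K / h ^ 2\<bar> < \<epsilon>"
            using m by simp
        qed
      qed
    qed
    with pos lim bound show ?case by blast
  qed
qed simp

end
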